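(* Let $k$ be a positive real number. The generating function $w_k(x)=\sum_{i=0}^{\infty} w_{k,i}x^{i}$ of the $k$-binomial transform $(w_{k,n})_{n\ge 0}$ of the modified $k$-Fibonacci-like sequence is, as a formal power series in $x$, $$w_{k}(x) = \frac{2(1-k^{2}x)}{1-k(k+2)x+k^{3}x^{2}}.$$
   Context: For a positive real number $k$, the modified $k$-Fibonacci-like sequence $(M_{k,n})_{n\ge 0}$ is defined by $M_{k,0}=M_{k,1}=2$ and $M_{k,n+1}=kM_{k,n}+M_{k,n-1}$ for $n\ge 1$. Its $k$-binomial transform $(w_{k,n})_{n\ge 0}$ is defined by $w_{k,n}=\sum_{i=0}^{n}\binom{n}{i}k^{n}M_{k,i}$. *)

theory Defs
  imports "HOL-Computational_Algebra.Formal_Power_Series"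
begin

fun mod_fib_like :: "real \<Rightarrow> nat \<Rightarrow> real" where
  "mod_fib_like k 0 = 2"
| "mod_fib_like k (Suc 0) = 2"
| "mod_fib_like k (Suc (Suc n)) = k * mod_fib_like k (Suc n) + mod_fib_like k n"

definition k_binomial_transform :: "real \<Rightarrow> (nat \<Rightarrow> real) \<Rightarrow> nat \<Rightarrow> real" where
  "k_binomial_transform k a n = (\<Sum>i\<le>n. real (n choose i) * k ^ n * a i)"

definition w_seq :: "real \<Rightarrow> nat \<Rightarrow> real" where
  "w_seq k = k_binomial_transform k (mod_fib_like k)"

end

theory Submission
  imports Defs
begin

text \<open>
  On sequences, the transform intertwines the index shift \<open>E\<close> with \<open>k (1 + E)\<close>: this is Pascal's
  rule. The Fibonacci-like sequence is annihilated by \<open>E\<^sup>2 - k E - 1\<close>, so its transform is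
  annihilated by the polynomial obtained from substituting \<open>E / k - 1\<close> for \<open>E\<close>, which up to the
  factor \<open>k\<^sup>2\<close> is \<open>E\<^sup>2 - k (k + 2) E + k\<^sup>3\<close>. The denominator of the generating function is the
  reciprocal of that polynomial, and the two initial values \<open>2\<close> and \<open>4 k\<close> determine the numerator.
\<close>

lemma k_binomial_transform_Suc:
  "k_binomial_transform k a (Suc n) =
     k * (k_binomial_transform k a n + k_binomial_transform k (\<lambda>i. a (Suc i)) n)"
proof -
  let ?c = "k ^ Suc n"
  have "k_binomial_transform k a (Suc n) =
      ?c * a 0 + (\<Sum>i\<le>n. real (Suc n choose Suc i) * ?c * a (Suc i))"
    unfolding k_binomial_transform_def by (subst sum.atMost_Suc_shift) simp
  also have "\<dots> = (?c * a 0 + (\<Sum>i\<le>n. real (n choose Suc i) * ?c * a (Suc i)))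
      + (\<Sum>i\<le>n. real (n choose i) * ?c * a (Suc i))"
    by (simp add: sum.distrib ring_distribs)
  \<comment> \<open>The term of index \<open>n + 1\<close> vanishes, so the first part is an unshifted sum over \<open>i \<le> n\<close>.\<close>
  also have "?c * a 0 + (\<Sum>i\<le>n. real (n choose Suc i) * ?c * a (Suc i))
      = (\<Sum>i\<le>Suc n. real (n choose i) * ?c * a i)"
    by (subst sum.atMost_Suc_shift) simp
  also have "\<dots> = (\<Sum>i\<le>n. real (n choose i) * ?c * a i)"
    by simp
  finally show ?thesis
    by (simp add: k_binomial_transform_def sum_distrib_left ring_distribs mult_ac)
qed

text \<open>
  Applying the shift rule twice involves the transform of the shifted sequence, which the rule
  itself expresses through two consecutive values of \<open>w\<close>; eliminating it leaves a recurrence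
  in \<open>w\<close> alone.
\<close>

lemma w_seq_recurrence:
  "w_seq k (Suc (Suc n)) = k * (k + 2) * w_seq k (Suc n) - k ^ 3 * w_seq k n"
proof -
  define v where "v = k_binomial_transform k (\<lambda>i. mod_fib_like k (Suc i))"
  have w_Suc: "w_seq k (Suc m) = k * (w_seq k m + v m)" for m
    unfolding w_seq_def v_def by (rule k_binomial_transform_Suc)
  have "k_binomial_transform k (\<lambda>i. mod_fib_like k (Suc (Suc i))) n = k * v n + w_seq k n"
    by (simp add: k_binomial_transform_def v_def w_seq_def sum_distrib_left sum.distrib
        ring_distribs mult_ac)
  then have v_Suc: "v (Suc n) = k * (v n + (k * v n + w_seq k n))"
    using k_binomial_transform_Suc[of k "\<lambda>i. mod_fib_like k (Suc i)" n] by (simp add: v_def)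
  show ?thesis
    unfolding w_Suc v_Suc by (simp add: algebra_simps power3_eq_cube)
qed

theorem mainTheorem6:
  fixes k :: real
  assumes "k > 0"
  shows "Abs_fps (w_seq k) =
    (2 * (1 - fps_const (k ^ 2) * fps_X)) /
    (1 - fps_const (k * (k + 2)) * fps_X + fps_const (k ^ 3) * fps_X ^ 2)"
proof -
  let ?W = "Abs_fps (w_seq k)"
  let ?D = "1 - fps_const (k * (k + 2)) * fps_X + fps_const (k ^ 3) * fps_X ^ 2"
  let ?N = "2 * (1 - fps_const (k ^ 2) * fps_X)"
  have w_0: "w_seq k 0 = 2" and w_1: "w_seq k (Suc 0) = 4 * k"
    by (simp_all add: w_seq_def k_binomial_transform_def)
  have expand: "?W * ?D = ?W - fps_const (k * (k + 2)) * (fps_X * ?W)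
      + fps_const (k ^ 3) * (fps_X * (fps_X * ?W))"
    by (simp only: power2_eq_square ring_distribs mult_ac mult_1_left)
  have N: "?N = fps_const 2 - fps_const (2 * k ^ 2) * fps_X"
    by (simp add: ring_distribs numeral_fps_const flip: fps_const_mult)
  have "fps_nth (?W * ?D) n = fps_nth ?N n" for n
  proof (cases n)
    case 0
    then show ?thesis
      unfolding expand N by (simp add: w_0)
  next
    case (Suc m)
    then show ?thesis
      unfolding expand N
      by (cases m) (simp_all add: w_0 w_1 w_seq_recurrence algebra_simps power2_eq_square)
  qed
  then have "?W * ?D = ?N"
    by (rule fps_ext)
  moreover have "?D \<noteq> 0"
  proof
    assume "?D = 0"
    then have "fps_nth ?D 0 = 0"
      by simp
    then show False
      by simp
  qed
  ultimately show ?thesis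
    by (metis nonzero_mult_div_cancel_right)
qed

end
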